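(* Let $\mathcal{A}$ be a projective arrangement in $\mathbb{P}^l$ and let $\tilde{\mathcal{A}}$ be the corresponding centrally symmetric sphere arrangement in $S^l$. Then the antipodal map $a$ on the sphere extends to its tangent bundle and \[M(\mathcal{A})\cong M(\tilde{\mathcal{A}})\big/\big((x,v)\sim a(x,v)\big).\]
   Context: $S^l$ is the unit sphere in $\mathbb{R}^{l+1}$, $\mathbb{P}^l$ is real projective space, and $S^l\to\mathbb{P}^l$ is the standard double covering map (also denoted $a$ in what follows when taking preimages). The extension of the antipodal map to $TS^l$ is $a(x,v)=(-x,-v)$. Conventions: $S^0$ is two points and the empty set is the sphere of dimension $-1$. A finite collection of codimension-$1$ subspheres of $S^l$ has locally flat intersections if every $x\in S^l$ has an open neighbourhood $V_x$ and a homeomorphism $\phi\colon V_x\to\mathbb{R}^l$ carrying the union of the traces on $V_x$ of the members containing $x$ onto the union of a central hyperplane arrangement in $\mathbb{R}^l$ with $\phi(x)$ as a common point. An arrangement of spheres in $S^l$ is a finite collection $\{S_1,\dots,S_k\}$ of codimension-$1$ smooth subspheres of $S^l$ such that: (1) the $S_i$ have locally flat intersections; (2) for all $I\subseteq\{1,\dots,k\}$ the intersection $\bigcap_{i\in I}S_i$ is a sphere of some dimension; (3) if $\bigcap_{i\in I}S_i\nsubseteq S_j$ then $\bigcap_{i\in I}S_i\cap S_j$ is a codimension-$1$ subsphere of $\bigcap_{i\in I}S_i$; (4) the stratification of $S^l$ induced by the intersections of the $S_i$ defines a regular CW-complex structure. It is centrally symmetric if there is a fixed-point free involutive diffeomorphism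 $f$ of $S^l$ (here the antipodal map) with $f(S_i)=S_i$ for all $i$. A finite collection $\mathcal{A}=\{H_1,\dots,H_n\}$ of codimension-$1$ projective spaces (subspaces homeomorphic to $\mathbb{P}^{l-1}$) in $\mathbb{P}^l$ is a projective arrangement if $\tilde{\mathcal{A}}:=\{a^{-1}(H): H\in\mathcal{A}\}$ is a centrally symmetric arrangement of spheres in $S^l$. The tangent bundle complements are $M(\tilde{\mathcal{A}}):=TS^l\setminus\bigcup_{S\in\tilde{\mathcal{A}}}TS$ and $M(\mathcal{A}):=T\mathbb{P}^l\setminus\bigcup_{H\in\mathcal{A}}TH$. *)

theory Defs
  imports "HOL-Analysis.Analysis"
begin

section \<open>Quotient spaces\<close>

definition quotient_topology :: "'a topology \<Rightarrow> ('a \<Rightarrow> 'b) \<Rightarrow> 'b topology" where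
  "quotient_topology X q =
     topology (\<lambda>U. U \<subseteq> q ` topspace X \<and> openin X {x \<in> topspace X. q x \<in> U})"

lemma openin_quotient_topology:
  "openin (quotient_topology X q) U \<longleftrightarrow>
     U \<subseteq> q ` topspace X \<and> openin X {x \<in> topspace X. q x \<in> U}"
proof -
  let ?L = "\<lambda>U. U \<subseteq> q ` topspace X \<and> openin X {x \<in> topspace X. q x \<in> U}"
  have "?L (S \<inter> T)" if "?L S" "?L T" for S T
  proof -
    have "{x \<in> topspace X. q x \<in> S \<inter> T}
        = {x \<in> topspace X. q x \<in> S} \<inter> {x \<in> topspace X. q x \<in> T}" by blast
    then show ?thesis using that by auto
  qed
  moreover have "?L (\<Union>K)" if "\<And>S. S \<in> K \<Longrightarrow> ?L S" for K
  proof -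
    have "{x \<in> topspace X. q x \<in> \<Union>K} = (\<Union>S\<in>K. {x \<in> topspace X. q x \<in> S})" by blast
    moreover have "openin X (\<Union>S\<in>K. {x \<in> topspace X. q x \<in> S})"
      using that by (intro openin_Union) auto
    moreover have "\<Union>K \<subseteq> q ` topspace X" using that by (intro Union_least) blast
    ultimately show ?thesis by simp
  qed
  ultimately have "istopology ?L" by (simp add: istopology_def)
  then show ?thesis by (simp add: quotient_topology_def topology_inverse')
qed

text \<open>The quotient by \<open>x \<sim> f x\<close>, meant for an involution \<open>f\<close> of the space \<open>X\<close>; its points are
  the orbits \<open>{x, f x}\<close>.\<close>

definition involution_quotient :: "'a topology \<Rightarrow> ('a \<Rightarrow> 'a) \<Rightarrow> 'a set topology" where
  "involution_quotient X f = quotient_topology X (\<lambda>x. {x, f x})"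


section \<open>Smooth maps and submanifolds of Euclidean space\<close>

text \<open>\<open>C\<^sup>k\<close> on an open set.\<close>

primrec Ck_on :: "nat \<Rightarrow> 'a::euclidean_space set \<Rightarrow> ('a \<Rightarrow> 'b::real_normed_vector) \<Rightarrow> bool" where
  "Ck_on 0 U f \<longleftrightarrow> continuous_on U f"
| "Ck_on (Suc k) U f \<longleftrightarrow> (\<forall>x\<in>U. f differentiable (at x)) \<and>
     (\<forall>v. Ck_on k U (\<lambda>x. frechet_derivative f (at x) v))"

definition smooth_on :: "'a::euclidean_space set \<Rightarrow> ('a \<Rightarrow> 'b::real_normed_vector) \<Rightarrow> bool" where
  "smooth_on U f \<longleftrightarrow> (\<forall>k. Ck_on k U f)"

definition smooth_submanifold :: "int \<Rightarrow> 'a::euclidean_space set \<Rightarrow> bool" where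
  "smooth_submanifold k S \<longleftrightarrow>
     (\<forall>p\<in>S. \<exists>U (V :: 'a set) \<psi> \<psi>' L. open U \<and> open V \<and> p \<in> U \<and> homeomorphism U V \<psi> \<psi>' \<and>
        smooth_on U \<psi> \<and> smooth_on V \<psi>' \<and>
        subspace L \<and> int (dim L) = k \<and> \<psi> ` (U \<inter> S) = V \<inter> L)"

text \<open>The tangent bundle of a submanifold \<open>S\<close> of Euclidean space: pairs \<open>(x, v)\<close> where \<open>v\<close> is
  the velocity at \<open>x\<close> of a smooth curve in \<open>S\<close>. It carries the subspace topology.\<close>

definition tangent_bundle :: "'a::euclidean_space set \<Rightarrow> ('a \<times> 'a) set" where
  "tangent_bundle S = {(x, v). \<exists>\<epsilon>>0. \<exists>\<gamma> :: real \<Rightarrow> 'a.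
     smooth_on {-\<epsilon><..<\<epsilon>} \<gamma> \<and> (\<forall>t\<in>{-\<epsilon><..<\<epsilon>}. \<gamma> t \<in> S) \<and>
     \<gamma> 0 = x \<and> (\<gamma> has_vector_derivative v) (at 0)}"


section \<open>The tangent bundle of an abstract manifold\<close>

text \<open>An atlas is a set of pairs of a chart domain and a chart. The charts may take their values
  in affine subspaces of the Euclidean space \<open>'e\<close>, so its dimension may exceed that of the
  manifold.\<close>

type_synonym ('m, 'e) atlas = "('m set \<times> ('m \<Rightarrow> 'e)) set"

text \<open>Curves are considered as germs at \<open>0\<close>: their values away from \<open>0\<close> are irrelevant.\<close>

definition smooth_curve :: "('m, 'e::euclidean_space) atlas \<Rightarrow> (real \<Rightarrow> 'm) \<Rightarrow> bool" where
  "smooth_curve \<A> \<gamma> \<longleftrightarrow> (\<exists>(U, \<phi>) \<in> \<A>. \<exists>\<epsilon>>0.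
     (\<forall>t\<in>{-\<epsilon><..<\<epsilon>}. \<gamma> t \<in> U) \<and> smooth_on {-\<epsilon><..<\<epsilon>} (\<lambda>t. \<phi> (\<gamma> t)))"

definition same_velocity ::
    "('m, 'e::euclidean_space) atlas \<Rightarrow> ((real \<Rightarrow> 'm) \<times> (real \<Rightarrow> 'm)) set" where
  "same_velocity \<A> = {(\<gamma>, \<delta>). smooth_curve \<A> \<gamma> \<and> smooth_curve \<A> \<delta> \<and> \<gamma> 0 = \<delta> 0 \<and>
     (\<forall>(U, \<phi>) \<in> \<A>. \<gamma> 0 \<in> U \<longrightarrow>
        vector_derivative (\<lambda>t. \<phi> (\<gamma> t)) (at 0) = vector_derivative (\<lambda>t. \<phi> (\<delta> t)) (at 0))}"

text \<open>A tangent vector is a class of smooth curves having the same velocity at \<open>0\<close>.\<close>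

definition tangent_vectors :: "('m, 'e::euclidean_space) atlas \<Rightarrow> (real \<Rightarrow> 'm) set set" where
  "tangent_vectors \<A> = {\<gamma>. smooth_curve \<A> \<gamma>} // same_velocity \<A>"

text \<open>The topology making the chart representations \<open>[\<gamma>] \<mapsto> (\<phi> (\<gamma> 0), (\<phi> \<circ> \<gamma>)' 0)\<close> charts.\<close>

definition tangent_bundle_topology ::
    "('m, 'e::euclidean_space) atlas \<Rightarrow> (real \<Rightarrow> 'm) set topology" where
  "tangent_bundle_topology \<A> = topology_generated_by
     {{\<xi> \<in> tangent_vectors \<A>. \<exists>\<gamma>\<in>\<xi>. \<gamma> 0 \<in> U \<and>
         (\<phi> (\<gamma> 0), vector_derivative (\<lambda>t. \<phi> (\<gamma> t)) (at 0)) \<in> W}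
      | U \<phi> W. (U, \<phi>) \<in> \<A> \<and> open W}"

text \<open>For a submanifold \<open>H\<close>, the image of \<open>TH\<close> in the tangent bundle of the ambient manifold.\<close>

definition tangent_vectors_in ::
    "('m, 'e::euclidean_space) atlas \<Rightarrow> 'm set \<Rightarrow> (real \<Rightarrow> 'm) set set" where
  "tangent_vectors_in \<A> H = {\<xi> \<in> tangent_vectors \<A>.
     \<exists>\<gamma>\<in>\<xi>. \<exists>\<epsilon>>0. \<forall>t\<in>{-\<epsilon><..<\<epsilon>}. \<gamma> t \<in> H}"


section \<open>Topological spheres\<close>

text \<open>The model of \<open>S\<^sup>d\<close> is the unit sphere of a \<open>(d + 1)\<close>-dimensional linear subspace of the
  ambient Euclidean space. The case \<open>d = -1\<close> (subspace \<open>{0}\<close>) gives the empty set and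
  \<open>d = 0\<close> gives two points.\<close>

definition is_sphere :: "int \<Rightarrow> 'a::euclidean_space set \<Rightarrow> bool" where
  "is_sphere d S \<longleftrightarrow>
     (\<exists>V :: 'a set. subspace V \<and> int (dim V) = d + 1 \<and> S homeomorphic (sphere 0 1 \<inter> V))"

definition codim1_subsphere :: "'a::euclidean_space set \<Rightarrow> 'a set \<Rightarrow> bool" where
  "codim1_subsphere S T \<longleftrightarrow> S \<subseteq> T \<and> (\<exists>d. is_sphere d T \<and> is_sphere (d - 1) S)"


section \<open>Sphere arrangements\<close>

text \<open>Throughout, \<open>S\<^sup>l\<close> is \<open>sphere 0 1\<close> in a Euclidean space of dimension \<open>l + 1\<close>, and \<open>\<real>\<^sup>l\<close> is
  modelled by \<open>l\<close>-dimensional linear subspaces \<open>L\<close> of that space; a hyperplane of \<open>L\<close> is given by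
  a normal vector \<open>n \<in> L - {0}\<close>.\<close>

definition locally_flat_intersections :: "nat \<Rightarrow> 'a::euclidean_space set set \<Rightarrow> bool" where
  "locally_flat_intersections l \<S> \<longleftrightarrow>
     (\<forall>x \<in> sphere 0 1. \<exists>V (L :: 'a set) \<phi> \<phi>' N. openin (top_of_set (sphere 0 1)) V \<and> x \<in> V \<and>
        subspace L \<and> dim L = l \<and> homeomorphism V L \<phi> \<phi>' \<and> finite N \<and> N \<subseteq> L - {0} \<and>
        \<phi> ` (V \<inter> \<Union>{S \<in> \<S>. x \<in> S}) = (\<Union>n\<in>N. {y \<in> L. n \<bullet> (y - \<phi> x) = 0}))"

text \<open>The strata are the connected components of the sets of points lying on exactly the members
  of a given subcollection.\<close>

definition strata :: "'a::euclidean_space set set \<Rightarrow> 'a set set" where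
  "strata \<S> = (\<Union>I \<in> Pow \<S>. components (sphere 0 1 \<inter> \<Inter>I - \<Union>(\<S> - I)))"

text \<open>A regular CW structure: all characteristic maps are homeomorphisms of closed balls onto
  closed cells.\<close>

definition regular_CW_complex :: "'a::euclidean_space set \<Rightarrow> 'a set set \<Rightarrow> bool" where
  "regular_CW_complex X \<C> \<longleftrightarrow>
     \<Union>\<C> = X \<and> pairwise disjnt \<C> \<and>
     (\<forall>e\<in>\<C>. \<exists>(V :: 'a set) h h'. subspace V \<and>
        homeomorphism (cball 0 1 \<inter> V) (X \<inter> closure e) h h' \<and> h ` (ball 0 1 \<inter> V) = e \<and>
        (\<exists>\<F>\<subseteq>\<C>. finite \<F> \<and> h ` (sphere 0 1 \<inter> V) \<subseteq> \<Union>\<F> \<and>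
           (\<forall>c\<in>\<F>. \<exists>W :: 'a set. subspace W \<and> dim W < dim V \<and> c homeomorphic (ball 0 1 \<inter> W)))) \<and>
     (\<forall>A\<subseteq>X. closedin (top_of_set X) A \<longleftrightarrow>
        (\<forall>e\<in>\<C>. closedin (top_of_set X) (A \<inter> closure e)))"

definition sphere_arrangement :: "nat \<Rightarrow> 'a::euclidean_space set set \<Rightarrow> bool" where
  "sphere_arrangement l \<S> \<longleftrightarrow>
     finite \<S> \<and>
     (\<forall>S\<in>\<S>. codim1_subsphere S (sphere 0 1) \<and> smooth_submanifold (int l - 1) S) \<and>
     locally_flat_intersections l \<S> \<and>
     (\<forall>I\<subseteq>\<S>. \<exists>d. is_sphere d (sphere 0 1 \<inter> \<Inter>I)) \<and>
     (\<forall>I\<subseteq>\<S>. \<forall>S\<in>\<S>. \<not> sphere 0 1 \<inter> \<Inter>I \<subseteq> S \<longrightarrow>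
        codim1_subsphere (sphere 0 1 \<inter> \<Inter>I \<inter> S) (sphere 0 1 \<inter> \<Inter>I)) \<and>
     regular_CW_complex (sphere 0 1) (strata \<S>)"

definition centrally_symmetric :: "'a::euclidean_space set set \<Rightarrow> bool" where
  "centrally_symmetric \<S> \<longleftrightarrow> (\<forall>S\<in>\<S>. uminus ` S = S)"


section \<open>Projective space and projective arrangements\<close>

definition projective_space :: "'a::euclidean_space set topology" where
  "projective_space = involution_quotient (top_of_set (sphere 0 1)) uminus"

definition covering_map :: "'a::euclidean_space \<Rightarrow> 'a set" where
  "covering_map x = {x, - x}"

text \<open>The standard charts: for \<open>x \<bullet> b \<noteq> 0\<close> the line through \<open>x\<close> has the affine coordinates
  \<open>x\<^sub>c / x\<^sub>b\<close>, i.e. it is represented by its point \<open>y\<close> with \<open>y \<bullet> b = 1\<close>.\<close>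

definition affine_chart :: "'a::euclidean_space \<Rightarrow> 'a set \<Rightarrow> 'a" where
  "affine_chart b p = (THE y. y \<in> span p \<and> y \<bullet> b = 1)"

definition projective_atlas :: "('a::euclidean_space set, 'a) atlas" where
  "projective_atlas =
     (\<lambda>b. ({p \<in> topspace projective_space. \<exists>x\<in>p. x \<bullet> b \<noteq> 0}, affine_chart b)) ` Basis"

text \<open>The model of \<open>\<P>\<^sup>d\<close> is the image in projective space of the unit sphere of a
  \<open>(d + 1)\<close>-dimensional linear subspace.\<close>

definition is_projective_subspace :: "int \<Rightarrow> 'a::euclidean_space set set \<Rightarrow> bool" where
  "is_projective_subspace d H \<longleftrightarrow> H \<subseteq> topspace projective_space \<and>
     (\<exists>V :: 'a set. subspace V \<and> int (dim V) = d + 1 \<and>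
        subtopology projective_space H homeomorphic_space
        subtopology projective_space (covering_map ` (sphere 0 1 \<inter> V)))"

definition lifted_arrangement :: "'a::euclidean_space set set set \<Rightarrow> 'a set set" where
  "lifted_arrangement \<A> = (\<lambda>H. {x \<in> sphere 0 1. covering_map x \<in> H}) ` \<A>"

definition projective_arrangement :: "nat \<Rightarrow> 'a::euclidean_space set set set \<Rightarrow> bool" where
  "projective_arrangement l \<A> \<longleftrightarrow>
     finite \<A> \<and> (\<forall>H\<in>\<A>. is_projective_subspace (int l - 1) H) \<and>
     sphere_arrangement l (lifted_arrangement \<A>) \<and>
     centrally_symmetric (lifted_arrangement \<A>)"


section \<open>Tangent bundle complements\<close>

definition sphere_complement :: "'a::euclidean_space set set \<Rightarrow> ('a \<times> 'a) set" where
  "sphere_complement \<S> = tangent_bundle (sphere 0 1) - (\<Union>S\<in>\<S>. tangent_bundle S)"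

definition projective_complement ::
    "'a::euclidean_space set set set \<Rightarrow> (real \<Rightarrow> 'a set) set topology" where
  "projective_complement \<A> =
     subtopology (tangent_bundle_topology projective_atlas)
       (tangent_vectors projective_atlas - (\<Union>H\<in>\<A>. tangent_vectors_in projective_atlas H))"

definition tangent_antipode :: "'a::euclidean_space \<times> 'a \<Rightarrow> 'a \<times> 'a" where
  "tangent_antipode = (\<lambda>(x, v). (- x, - v))"

end

theory Submission
  imports Defs
begin

text \<open>The derivative of the double covering \<open>S\<^sup>l \<rightarrow> \<P>\<^sup>l\<close> is a double covering
  \<open>TS\<^sup>l \<rightarrow> T\<P>\<^sup>l\<close> whose fibres are the orbits of \<open>(x, v) \<mapsto> (- x, - v)\<close>. It maps exactly the
  vectors tangent to the lift of \<open>H\<close> to the vectors tangent to \<open>H\<close>, because a curve in \<open>S\<^sup>l\<close> stays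
  in the lift of \<open>H\<close> iff its image stays in \<open>H\<close>. So the complement \<open>M\<close> of the lifted arrangement
  is the full preimage of the complement in \<open>T\<P>\<^sup>l\<close>, and it only remains to see that the map
  between the complements is a quotient map: two quotient maps on one space with the same fibres
  have homeomorphic targets.

  Tangent vectors of projective space being classes of curves, the covering \<open>velocity_class\<close>
  sends \<open>(x, v)\<close> to the set of all curves that lift, near time \<open>0\<close>, to a smooth curve in the sphere
  with initial point \<open>x\<close> and velocity \<open>v\<close>. Two facts about lifts make this set a tangent vector
  (\<open>velocity_class_is_class\<close>): a curve that is smooth in an affine chart lifts by normalising
  its chart representation \<open>y\<close> to \<open>y / |y|\<close>, and conversely a lift \<open>c\<close> has the smooth
  representation \<open>c / (c \<bullet> b)\<close>.

  In the chart of the basis vector \<open>b\<close> the covering becomes the explicit map \<open>chart_rep b\<close>, which is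
  continuous. On a half-sphere \<open>x \<bullet> b > 0\<close> or \<open>x \<bullet> b < 0\<close> it is inverted, up to sign, by
  \<open>radial\<close>, the derivative of \<open>y \<mapsto> y / |y|\<close>; hence the covering is open
  (\<open>open_map_velocity_class\<close>) and its fibres are \<open>{p, - p}\<close> (\<open>velocity_class_eq_iff\<close>). An open
  continuous map stays open when it is restricted to a full preimage, and so it is a quotient map
  there.\<close>

section \<open>Calculus of smooth maps\<close>

lemma Ck_on_subset: "Ck_on k U f \<Longrightarrow> V \<subseteq> U \<Longrightarrow> Ck_on k V f"
  by (induction k arbitrary: f) (auto intro: continuous_on_subset)

lemma Ck_on_cong:
  assumes "open U" and "\<And>x. x \<in> U \<Longrightarrow> f x = g x" and "Ck_on k U f"
  shows "Ck_on k U g"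
  using assms(2,3)
proof (induction k arbitrary: f g)
  case 0
  then show ?case by (metis Ck_on.simps(1) continuous_on_cong)
next
  case (Suc k)
  have diff: "g differentiable (at x)" if "x \<in> U" for x
  proof -
    obtain D where "(f has_derivative D) (at x)"
      using Suc.prems(2) \<open>x \<in> U\<close> by (auto simp: differentiable_def)
    then have "(g has_derivative D) (at x)"
      using has_derivative_transform_within_open[OF _ \<open>open U\<close> \<open>x \<in> U\<close>] Suc.prems(1) by blast
    then show ?thesis by (rule differentiableI)
  qed
  have "Ck_on k U (\<lambda>x. frechet_derivative g (at x) v)" for v
  proof (rule Suc.IH)
    fix x assume "x \<in> U"
    then show "frechet_derivative f (at x) v = frechet_derivative g (at x) v"
      using frechet_derivative_transform_within_open[OF _ \<open>open U\<close> \<open>x \<in> U\<close>, of f g] Suc.prems by simp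
  next
    show "Ck_on k U (\<lambda>x. frechet_derivative f (at x) v)" using Suc.prems(2) by simp
  qed
  with diff show ?case by simp
qed

lemma Ck_on_SucI:
  assumes "open U" and "\<And>x. x \<in> U \<Longrightarrow> (f has_derivative D x) (at x)"
    and "\<And>v. Ck_on k U (\<lambda>x. D x v)"
  shows "Ck_on (Suc k) U f"
proof -
  have "Ck_on k U (\<lambda>x. frechet_derivative f (at x) v)" for v
    by (rule Ck_on_cong[OF assms(1) _ assms(3)[of v]])
       (use frechet_derivative_at[OF assms(2)] in auto)
  then show ?thesis using assms(2) by (auto intro: differentiableI)
qed

lemma Ck_on_SucD:
  assumes "Ck_on (Suc k) U f" and "x \<in> U"
  shows "(f has_derivative frechet_derivative f (at x)) (at x)"
  using assms by (simp add: frechet_derivative_works)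

lemma Ck_on_Suc_imp:
  assumes "Ck_on (Suc k) U f"
  shows "Ck_on k U f"
  using assms
proof (induction k arbitrary: f)
  case 0
  then show ?case
    by (auto intro!: continuous_at_imp_continuous_on differentiable_imp_continuous_within)
next
  case (Suc k)
  have "Ck_on k U (\<lambda>x. frechet_derivative f (at x) v)" for v
    using Suc.prems by (intro Suc.IH) simp
  then show ?case using Suc.prems by simp
qed

lemma Ck_on_const: "Ck_on k U (\<lambda>x. c)"
  by (induction k arbitrary: c) auto

lemma Ck_on_ident: "Ck_on k U (\<lambda>x. x)"
  by (cases k) (auto simp: Ck_on_const)

lemma Ck_on_add:
  assumes "open U" "Ck_on k U f" "Ck_on k U g"
  shows "Ck_on k U (\<lambda>x. f x + g x)"
  using assms(2,3)
proof (induction k arbitrary: f g)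
  case 0
  then show ?case by (auto intro: continuous_on_add)
next
  case (Suc k)
  show ?case
  proof (rule Ck_on_SucI[OF \<open>open U\<close>])
    show "((\<lambda>x. f x + g x) has_derivative
        (\<lambda>v. frechet_derivative f (at x) v + frechet_derivative g (at x) v)) (at x)"
      if "x \<in> U" for x
      using Suc.prems that by (intro has_derivative_add Ck_on_SucD)
    show "Ck_on k U (\<lambda>x. frechet_derivative f (at x) v + frechet_derivative g (at x) v)" for v
      using Suc.prems by (intro Suc.IH) auto
  qed
qed

lemma Ck_on_bilinear:
  assumes "bounded_bilinear B" "open U" "Ck_on k U f" "Ck_on k U g"
  shows "Ck_on k U (\<lambda>x. B (f x) (g x))"
  using assms(3,4)
proof (induction k arbitrary: f g)
  case 0
  then show ?case using bounded_bilinear.continuous_on[OF assms(1)] by auto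
next
  case (Suc k)
  show ?case
  proof (rule Ck_on_SucI[OF \<open>open U\<close>])
    show "((\<lambda>x. B (f x) (g x)) has_derivative
        (\<lambda>v. B (f x) (frechet_derivative g (at x) v) + B (frechet_derivative f (at x) v) (g x)))
        (at x)" if "x \<in> U" for x
      using Suc.prems that by (intro bounded_bilinear.FDERIV[OF assms(1)] Ck_on_SucD)
    show "Ck_on k U (\<lambda>x. B (f x) (frechet_derivative g (at x) v)
        + B (frechet_derivative f (at x) v) (g x))" for v
      using Suc.prems Ck_on_Suc_imp[OF Suc.prems(1)] Ck_on_Suc_imp[OF Suc.prems(2)]
      by (intro Ck_on_add[OF \<open>open U\<close>] Suc.IH) auto
  qed
qed

text \<open>The induction is over all exponents at once, since differentiating \<open>f powr a\<close> produces
  \<open>f powr (a - 1)\<close>. This one family yields both reciprocals and norms.\<close>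

lemma Ck_on_powr:
  fixes f :: "'a::euclidean_space \<Rightarrow> real"
  assumes "open U" "Ck_on k U f" "\<And>x. x \<in> U \<Longrightarrow> f x > 0"
  shows "Ck_on k U (\<lambda>x. f x powr a)"
  using assms(2)
proof (induction k arbitrary: a)
  case 0
  then show ?case
    using assms(3) by (auto intro!: continuous_on_powr continuous_on_const simp: less_imp_neq[symmetric])
next
  case (Suc k)
  show ?case
  proof (rule Ck_on_SucI[OF \<open>open U\<close>])
    show "((\<lambda>x. f x powr a) has_derivative
        (\<lambda>v. a * (f x powr (a - 1) * frechet_derivative f (at x) v))) (at x)" if "x \<in> U" for x
      using has_derivative_powr[OF Ck_on_SucD[OF Suc.prems that] has_derivative_const, of a]
        assms(3)[OF that]
      by (simp add: powr_diff mult_ac)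
    show "Ck_on k U (\<lambda>x. a * (f x powr (a - 1) * frechet_derivative f (at x) v))" for v
      using Suc.prems Ck_on_Suc_imp[OF Suc.prems]
      by (intro Ck_on_bilinear[OF bounded_bilinear_mult \<open>open U\<close>] Ck_on_const Suc.IH) auto
  qed
qed

lemma smooth_on_subset: "smooth_on U f \<Longrightarrow> V \<subseteq> U \<Longrightarrow> smooth_on V f"
  unfolding smooth_on_def using Ck_on_subset by blast

lemma smooth_on_cong:
  "open U \<Longrightarrow> (\<And>x. x \<in> U \<Longrightarrow> f x = g x) \<Longrightarrow> smooth_on U f \<Longrightarrow> smooth_on U g"
  unfolding smooth_on_def using Ck_on_cong by blast

lemma smooth_on_bilinear:
  "bounded_bilinear B \<Longrightarrow> open U \<Longrightarrow> smooth_on U f \<Longrightarrow> smooth_on U g \<Longrightarrow>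
    smooth_on U (\<lambda>x. B (f x) (g x))"
  unfolding smooth_on_def using Ck_on_bilinear by blast

lemmas smooth_on_scaleR = smooth_on_bilinear[OF bounded_bilinear_scaleR]
  and smooth_on_inner = smooth_on_bilinear[OF bounded_bilinear_inner]
  and smooth_on_mult = smooth_on_bilinear[OF bounded_bilinear_mult]

lemma smooth_on_const: "smooth_on U (\<lambda>x. c)"
  by (simp add: smooth_on_def Ck_on_const)

lemma smooth_on_affine_line:
  fixes x v :: "'a::euclidean_space"
  shows "open U \<Longrightarrow> smooth_on U (\<lambda>t::real. x + t *\<^sub>R v)"
  unfolding smooth_on_def
  by (intro allI Ck_on_add Ck_on_bilinear[OF bounded_bilinear_scaleR] Ck_on_const Ck_on_ident)

lemma smooth_on_powr:
  fixes f :: "'a::euclidean_space \<Rightarrow> real"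
  shows "open U \<Longrightarrow> smooth_on U f \<Longrightarrow> (\<And>x. x \<in> U \<Longrightarrow> f x > 0) \<Longrightarrow> smooth_on U (\<lambda>x. f x powr a)"
  unfolding smooth_on_def using Ck_on_powr by blast

lemma smooth_on_inverse:
  fixes f :: "'a::euclidean_space \<Rightarrow> real"
  assumes "open U" "smooth_on U f" "\<And>x. x \<in> U \<Longrightarrow> f x \<noteq> 0"
  shows "smooth_on U (\<lambda>x. inverse (f x))"
proof (rule smooth_on_cong[OF \<open>open U\<close>])
  \<comment> \<open>Squaring makes the base of the power positive whatever the sign of \<open>f\<close>.\<close>
  show "smooth_on U (\<lambda>x. f x * (f x * f x) powr - 1)"
    using assms
    by (intro smooth_on_mult smooth_on_powr) (auto simp: zero_less_mult_iff linorder_neq_iff)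
  show "f x * (f x * f x) powr - 1 = inverse (f x)" if "x \<in> U" for x
    using assms(3)[OF that] by (simp add: powr_minus field_simps)
qed

lemma sgn_eq_powr:
  fixes y :: "'a::real_inner"
  assumes "y \<noteq> 0"
  shows "sgn y = ((y \<bullet> y) powr (- (1/2))) *\<^sub>R y"
  using assms by (simp add: sgn_div_norm powr_minus powr_half_sqrt norm_eq_sqrt_inner)

lemma sgn_scaleR_unit:
  fixes x :: "'a::real_normed_vector"
  assumes "norm x = 1"
  shows "sgn (inverse a *\<^sub>R x) = sgn a *\<^sub>R x"
  using assms by (cases "a = 0") (auto simp: sgn_scaleR sgn_div_norm[of x] sgn_real_def)

lemma smooth_on_sgn:
  fixes f :: "'a::euclidean_space \<Rightarrow> 'b::euclidean_space"
  assumes "open U" "smooth_on U f" "\<And>x. x \<in> U \<Longrightarrow> f x \<noteq> 0"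
  shows "smooth_on U (\<lambda>x. sgn (f x))"
proof (rule smooth_on_cong[OF \<open>open U\<close>])
  show "smooth_on U (\<lambda>x. ((f x \<bullet> f x) powr (- (1/2))) *\<^sub>R f x)"
    using assms by (intro smooth_on_scaleR smooth_on_powr smooth_on_inner) auto
qed (simp add: sgn_eq_powr assms(3))

lemma smooth_on_imp_has_vector_derivative:
  fixes f :: "real \<Rightarrow> 'a::real_normed_vector"
  assumes "smooth_on U f" "t \<in> U"
  shows "(f has_vector_derivative vector_derivative f (at t)) (at t)"
proof -
  have "Ck_on (Suc 0) U f" using assms(1) by (simp add: smooth_on_def del: Ck_on.simps)
  then show ?thesis using assms(2) by (simp add: vector_derivative_works)
qed

section \<open>The tangent bundle of the sphere\<close>

text \<open>Differentiating \<open>\<gamma> \<bullet> \<gamma> = 1\<close> makes velocities orthogonal to the base point. Conversely the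
  normalised line \<open>x + t v\<close> has velocity \<open>v\<close>, because \<open>|x + t v|\<^sup>2 = 1 + t\<^sup>2 |v|\<^sup>2\<close> is stationary
  at \<open>0\<close>.\<close>

lemma tangent_bundle_sphere:
  "tangent_bundle (sphere (0::'a::euclidean_space) 1) = {(x, v). norm x = 1 \<and> x \<bullet> v = 0}"
proof (intro set_eqI iffI; clarsimp)
  fix x v :: 'a
  assume "(x, v) \<in> tangent_bundle (sphere 0 1)"
  then obtain \<epsilon> \<gamma> where "\<epsilon> > 0" and on: "\<forall>t\<in>{-\<epsilon><..<\<epsilon>}. norm (\<gamma> t) = 1"
    and "\<gamma> 0 = x" and der: "(\<gamma> has_vector_derivative v) (at 0)"
    by (auto simp: tangent_bundle_def)
  have "((\<lambda>t. \<gamma> t \<bullet> \<gamma> t) has_vector_derivative (\<gamma> 0 \<bullet> v + v \<bullet> \<gamma> 0)) (at 0)"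
    by (rule bounded_bilinear.has_vector_derivative[OF bounded_bilinear_inner der der])
  moreover have "((\<lambda>t. \<gamma> t \<bullet> \<gamma> t) has_vector_derivative 0) (at 0)"
    by (rule has_vector_derivative_transform_within_open[OF has_vector_derivative_const,
          where S = "{-\<epsilon><..<\<epsilon>}" and f2 = 1])
       (use on \<open>\<epsilon> > 0\<close> in \<open>auto simp: dot_square_norm\<close>)
  ultimately have "\<gamma> 0 \<bullet> v + v \<bullet> \<gamma> 0 = 0" by (rule vector_derivative_unique_at)
  then have "x \<bullet> v = 0" by (simp add: \<open>\<gamma> 0 = x\<close> inner_commute)
  moreover have "norm x = 1" using on \<open>\<epsilon> > 0\<close> \<open>\<gamma> 0 = x\<close> by auto
  ultimately show "norm x = 1 \<and> x \<bullet> v = 0" by simp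
next
  fix x v :: 'a
  assume x: "norm x = 1" and xv: "x \<bullet> v = 0"
  let ?y = "\<lambda>t::real. x + t *\<^sub>R v"
  have sq: "?y t \<bullet> ?y t = 1 + t\<^sup>2 * (v \<bullet> v)" for t
    using x xv
    by (simp add: norm_eq_1 inner_add_left inner_add_right inner_commute[of v x] power2_eq_square)
  have "?y t \<bullet> ?y t > 0" for t unfolding sq by (simp add: add_pos_nonneg)
  then have nz: "?y t \<noteq> 0" for t by (metis inner_zero_left less_irrefl)
  have "smooth_on {-1<..<1} (\<lambda>t. sgn (?y t))"
    using nz by (intro smooth_on_sgn smooth_on_affine_line) auto
  moreover have "\<forall>t\<in>{-1<..<1}. sgn (?y t) \<in> sphere 0 1" using nz by (simp add: norm_sgn)
  moreover have "sgn (?y 0) = x" using x by (simp add: sgn_div_norm)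
  moreover have "((\<lambda>t. sgn (?y t)) has_vector_derivative v) (at 0)"
  proof -
    have eq: "(\<lambda>t. sgn (?y t)) = (\<lambda>t. ((1 + t\<^sup>2 * (v \<bullet> v)) powr (- (1/2))) *\<^sub>R ?y t)"
      using sgn_eq_powr[OF nz] sq by auto
    show ?thesis unfolding eq
      by (rule derivative_eq_intros refl | simp)+
  qed
  ultimately show "(x, v) \<in> tangent_bundle (sphere 0 1)"
    unfolding tangent_bundle_def by (auto intro!: exI[of _ 1] exI[of _ "\<lambda>t. sgn (?y t)"])
qed


lemma tangent_antipode_eq: "tangent_antipode p = - p"
  by (cases p) (simp add: tangent_antipode_def)

section \<open>Points and charts of projective space\<close>

lemma covering_map_eq_iff: "covering_map x = covering_map y \<longleftrightarrow> y = x \<or> y = - x"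
  by (auto simp: covering_map_def doubleton_eq_iff)

lemma covering_map_uminus [simp]: "covering_map (- x) = covering_map x"
  by (auto simp: covering_map_def)

lemma quotient_map_quotient_topology: "quotient_map X (quotient_topology X q) q"
proof -
  have "openin (quotient_topology X q) (q ` topspace X)"
    by (auto simp: openin_quotient_topology intro: back_subst[of "openin X", OF openin_topspace])
  then have "topspace (quotient_topology X q) = q ` topspace X"
    by (metis openin_quotient_topology openin_subset openin_topspace subset_antisym)
  then show ?thesis by (simp add: quotient_map_def openin_quotient_topology)
qed

lemma topspace_projective_space:
  "topspace projective_space = covering_map ` sphere (0::'a::euclidean_space) 1"
proof -
  have "quotient_map (top_of_set (sphere (0::'a) 1)) projective_space covering_map"
    using quotient_map_quotient_topology
    unfolding projective_space_def involution_quotient_def covering_map_def by blast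
  then show ?thesis by (simp add: quotient_map_def)
qed

definition chart_domain :: "'a::euclidean_space \<Rightarrow> 'a set set" where
  "chart_domain b = {p \<in> topspace projective_space. \<exists>x\<in>p. x \<bullet> b \<noteq> 0}"

lemma projective_atlas_eq: "projective_atlas = (\<lambda>b. (chart_domain b, affine_chart b)) ` Basis"
  by (simp add: projective_atlas_def chart_domain_def)

lemma covering_map_in_chart_domain:
  "norm x = 1 \<Longrightarrow> covering_map x \<in> chart_domain b \<longleftrightarrow> x \<bullet> b \<noteq> 0"
  by (auto simp: chart_domain_def topspace_projective_space covering_map_def)

lemma affine_chart_covering_map:
  assumes "x \<bullet> b \<noteq> 0"
  shows "affine_chart b (covering_map x) = inverse (x \<bullet> b) *\<^sub>R x"
  unfolding affine_chart_def
proof (rule the_equality)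
  have "inverse (x \<bullet> b) *\<^sub>R x \<in> span (covering_map x)"
    by (intro span_scale span_base) (simp add: covering_map_def)
  then show "inverse (x \<bullet> b) *\<^sub>R x \<in> span (covering_map x) \<and> (inverse (x \<bullet> b) *\<^sub>R x) \<bullet> b = 1"
    using assms by simp
next
  fix y assume y: "y \<in> span (covering_map x) \<and> y \<bullet> b = 1"
  have "covering_map x \<subseteq> span {x}"
    by (auto simp: covering_map_def intro: span_base span_neg)
  then have "y \<in> span {x}" using y span_minimal[OF _ subspace_span] by blast
  then obtain k where k: "y = k *\<^sub>R x" by (auto simp: span_singleton)
  then have "k * (x \<bullet> b) = 1" using y by simp
  then have "k = inverse (x \<bullet> b)" by (simp add: inverse_unique mult.commute)
  then show "y = inverse (x \<bullet> b) *\<^sub>R x" by (simp add: k)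
qed

lemma exists_chart:
  fixes x :: "'a::euclidean_space"
  assumes "norm x = 1"
  obtains b where "b \<in> Basis" "x \<bullet> b \<noteq> 0"
proof -
  have "x \<noteq> 0" using assms by auto
  then show ?thesis using that by (metis euclidean_all_zero_iff)
qed

section \<open>Tangent vectors of projective space\<close>

text \<open>The image of the vector \<open>p = (x, v)\<close> under the derivative of the covering, described through
  lifts instead of as the class of one chosen curve: then the invariance under the antipode and the
  comparison with vectors tangent to a submanifold can be read off from the lift.\<close>

definition velocity_class :: "'a::euclidean_space \<times> 'a \<Rightarrow> (real \<Rightarrow> 'a set) set" where
  "velocity_class p = {\<gamma>. \<exists>\<epsilon>>0. \<exists>c. smooth_on {-\<epsilon><..<\<epsilon>} c \<and>
     (\<forall>t\<in>{-\<epsilon><..<\<epsilon>}. norm (c t) = 1 \<and> \<gamma> t = covering_map (c t)) \<and>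
     c 0 = fst p \<and> (c has_vector_derivative snd p) (at 0)}"

lemma velocity_classE:
  assumes "\<gamma> \<in> velocity_class (x, v)"
  obtains \<epsilon> c where "\<epsilon> > 0" "smooth_on {-\<epsilon><..<\<epsilon>} c"
    "\<And>t. t \<in> {-\<epsilon><..<\<epsilon>} \<Longrightarrow> norm (c t) = 1"
    "\<And>t. t \<in> {-\<epsilon><..<\<epsilon>} \<Longrightarrow> \<gamma> t = covering_map (c t)"
    "c 0 = x" "(c has_vector_derivative v) (at 0)"
  using assms unfolding velocity_class_def by auto

lemma velocity_classI:
  assumes "\<epsilon> > 0" "smooth_on {-\<epsilon><..<\<epsilon>} c"
    "\<And>t. t \<in> {-\<epsilon><..<\<epsilon>} \<Longrightarrow> norm (c t) = 1"
    "\<And>t. t \<in> {-\<epsilon><..<\<epsilon>} \<Longrightarrow> \<gamma> t = covering_map (c t)"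
    "c 0 = x" "(c has_vector_derivative v) (at 0)"
  shows "\<gamma> \<in> velocity_class (x, v)"
  using assms unfolding velocity_class_def mem_Collect_eq fst_conv snd_conv by blast

lemma velocity_class_uminus [simp]: "velocity_class (- p) = velocity_class p"
proof -
  have "velocity_class p \<subseteq> velocity_class (- p)" for p :: "'a \<times> 'a"
  proof (cases p)
    case (Pair x v)
    show ?thesis
    proof
      fix \<gamma> assume "\<gamma> \<in> velocity_class p"
      then obtain \<epsilon> c where c: "\<epsilon> > 0" "smooth_on {-\<epsilon><..<\<epsilon>} c"
        "\<And>t. t \<in> {-\<epsilon><..<\<epsilon>} \<Longrightarrow> norm (c t) = 1"
        "\<And>t. t \<in> {-\<epsilon><..<\<epsilon>} \<Longrightarrow> \<gamma> t = covering_map (c t)"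
        "c 0 = x" "(c has_vector_derivative v) (at 0)"
        unfolding Pair by (rule velocity_classE) blast
      have "smooth_on {-\<epsilon><..<\<epsilon>} (\<lambda>t. (- 1) *\<^sub>R c t)"
        by (intro smooth_on_scaleR smooth_on_const c) auto
      then have "\<gamma> \<in> velocity_class (- x, - v)"
        using c by (intro velocity_classI[of \<epsilon> "\<lambda>t. - c t"]) (auto intro: has_vector_derivative_minus)
      then show "\<gamma> \<in> velocity_class (- p)" by (simp add: Pair)
    qed
  qed
  from this[of p] this[of "- p"] show ?thesis by simp
qed

lemma tangent_bundle_sphere_uminus_iff [simp]:
  "- p \<in> tangent_bundle (sphere 0 1) \<longleftrightarrow> p \<in> tangent_bundle (sphere 0 1)"
  by (cases p) (simp add: tangent_bundle_sphere)

lemma velocity_class_base: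
  assumes "\<gamma> \<in> velocity_class (x, v)"
  shows "\<gamma> 0 = covering_map x" and "(x, v) \<in> tangent_bundle (sphere 0 1)"
proof -
  obtain \<epsilon> c where c: "\<epsilon> > 0" "smooth_on {-\<epsilon><..<\<epsilon>} c"
    "\<And>t. t \<in> {-\<epsilon><..<\<epsilon>} \<Longrightarrow> norm (c t) = 1"
    "\<And>t. t \<in> {-\<epsilon><..<\<epsilon>} \<Longrightarrow> \<gamma> t = covering_map (c t)"
    "c 0 = x" "(c has_vector_derivative v) (at 0)"
    using assms by (rule velocity_classE) blast
  show "\<gamma> 0 = covering_map x" using c(1,4,5) by simp
  have "\<forall>t\<in>{-\<epsilon><..<\<epsilon>}. c t \<in> sphere 0 1" using c(3) by simp
  then show "(x, v) \<in> tangent_bundle (sphere 0 1)"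
    unfolding tangent_bundle_def using c(1,2,5,6) by blast
qed

lemma velocity_class_nonempty:
  assumes "p \<in> tangent_bundle (sphere 0 1)"
  shows "velocity_class p \<noteq> {}"
proof (cases p)
  case (Pair x v)
  obtain \<epsilon> c where c: "\<epsilon> > 0" "smooth_on {-\<epsilon><..<\<epsilon>} c" "\<forall>t\<in>{-\<epsilon><..<\<epsilon>}. c t \<in> sphere 0 1"
    "c 0 = x" "(c has_vector_derivative v) (at 0)"
    using assms unfolding Pair tangent_bundle_def by blast
  then have "(\<lambda>t. covering_map (c t)) \<in> velocity_class (x, v)"
    by (intro velocity_classI[of \<epsilon> c]) auto
  then show ?thesis using Pair by blast
qed

text \<open>The derivative of \<open>x \<mapsto> x / (x \<bullet> b)\<close>, together with the base point: the covering of tangent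
  bundles seen in the affine chart of \<open>b\<close>.\<close>

definition chart_rep :: "'a::euclidean_space \<Rightarrow> 'a \<times> 'a \<Rightarrow> 'a \<times> 'a" where
  "chart_rep b = (\<lambda>(x, v). (inverse (x \<bullet> b) *\<^sub>R x,
     inverse (x \<bullet> b) *\<^sub>R v - ((v \<bullet> b) / (x \<bullet> b)\<^sup>2) *\<^sub>R x))"

lemma chart_nbhd:
  fixes c :: "real \<Rightarrow> 'a::euclidean_space"
  assumes "\<epsilon> > 0" "smooth_on {-\<epsilon><..<\<epsilon>} c" "c 0 \<bullet> b \<noteq> 0"
  obtains \<delta> where "\<delta> > 0" "\<delta> \<le> \<epsilon>" "\<And>t. t \<in> {-\<delta><..<\<delta>} \<Longrightarrow> c t \<bullet> b \<noteq> 0"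
proof -
  have "isCont c 0"
    using smooth_on_imp_has_vector_derivative[OF assms(2), of 0] assms(1)
    by (auto intro: has_vector_derivative_continuous)
  then have "isCont (\<lambda>t. c t \<bullet> b) 0" by (intro continuous_intros)
  then have "\<forall>\<^sub>F t in at 0. c t \<bullet> b \<noteq> 0"
    using assms(3) by (simp add: isCont_def tendsto_imp_eventually_ne)
  then obtain d where d: "d > 0" "\<And>t. t \<noteq> 0 \<Longrightarrow> dist t 0 < d \<Longrightarrow> c t \<bullet> b \<noteq> 0"
    by (auto simp: eventually_at)
  show ?thesis
  proof (rule that[of "min d \<epsilon>"])
    show "c t \<bullet> b \<noteq> 0" if "t \<in> {- min d \<epsilon><..<min d \<epsilon>}" for t
      proof (cases "t = 0")
      case False
      moreover have "dist t 0 < d" using that by (auto simp: dist_real_def)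
      ultimately show ?thesis by (rule d(2))
    qed (use assms(3) in simp)
  qed (use d(1) assms(1) in auto)
qed

text \<open>Near time \<open>0\<close> the lift \<open>c\<close> stays away from the hyperplane \<open>c \<bullet> b = 0\<close>, and there the chart
  representation of the curve is the smooth map \<open>c / (c \<bullet> b)\<close>.\<close>

lemma velocity_class_chart:
  assumes \<gamma>: "\<gamma> \<in> velocity_class (x, v)" and xb: "x \<bullet> b \<noteq> 0"
  shows "affine_chart b (\<gamma> 0) = fst (chart_rep b (x, v))"
    and "((\<lambda>t. affine_chart b (\<gamma> t)) has_vector_derivative snd (chart_rep b (x, v))) (at 0)"
    and "\<exists>\<delta>>0. (\<forall>t\<in>{-\<delta><..<\<delta>}. \<gamma> t \<in> chart_domain b) \<and>
           smooth_on {-\<delta><..<\<delta>} (\<lambda>t. affine_chart b (\<gamma> t))"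
proof -
  show "affine_chart b (\<gamma> 0) = fst (chart_rep b (x, v))"
    by (simp add: velocity_class_base(1)[OF \<gamma>] affine_chart_covering_map[OF xb] chart_rep_def)
  obtain \<epsilon> c where c: "\<epsilon> > 0" "smooth_on {-\<epsilon><..<\<epsilon>} c"
    "\<And>t. t \<in> {-\<epsilon><..<\<epsilon>} \<Longrightarrow> norm (c t) = 1"
    "\<And>t. t \<in> {-\<epsilon><..<\<epsilon>} \<Longrightarrow> \<gamma> t = covering_map (c t)"
    "c 0 = x" "(c has_vector_derivative v) (at 0)"
    using \<gamma> by (rule velocity_classE) blast
  obtain \<delta> where \<delta>: "\<delta> > 0" "\<delta> \<le> \<epsilon>" "\<And>t. t \<in> {-\<delta><..<\<delta>} \<Longrightarrow> c t \<bullet> b \<noteq> 0"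
    using chart_nbhd[OF c(1,2), of b] xb c(5) by metis
  have eq: "affine_chart b (\<gamma> t) = inverse (c t \<bullet> b) *\<^sub>R c t" if "t \<in> {-\<delta><..<\<delta>}" for t
    using c(4)[of t] affine_chart_covering_map[OF \<delta>(3)[OF that]] that \<delta>(2) by simp
  have "((\<lambda>t. c t \<bullet> b) has_vector_derivative c 0 \<bullet> 0 + v \<bullet> b) (at 0)"
    by (rule bounded_bilinear.has_vector_derivative[OF bounded_bilinear_inner c(6)
          has_vector_derivative_const])
  then have "((\<lambda>t. c t \<bullet> b) has_real_derivative v \<bullet> b) (at 0)"
    by (simp add: has_real_derivative_iff_has_vector_derivative)
  then have "((\<lambda>t. inverse (c t \<bullet> b)) has_real_derivative - ((v \<bullet> b) / (x \<bullet> b)\<^sup>2)) (at 0)"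
    using xb c(5) by (auto intro!: derivative_eq_intros simp: power2_eq_square field_simps)
  from has_vector_derivative_scaleR[OF this c(6)]
  have "((\<lambda>t. inverse (c t \<bullet> b) *\<^sub>R c t) has_vector_derivative snd (chart_rep b (x, v))) (at 0)"
    by (simp add: chart_rep_def c(5))
  then show "((\<lambda>t. affine_chart b (\<gamma> t)) has_vector_derivative snd (chart_rep b (x, v))) (at 0)"
    by (rule has_vector_derivative_transform_within_open[where S = "{-\<delta><..<\<delta>}"])
       (use \<delta>(1) eq in auto)
  have "smooth_on {-\<delta><..<\<delta>} c"
    using \<delta>(2) by (intro smooth_on_subset[OF c(2)]) auto
  then have "smooth_on {-\<delta><..<\<delta>} (\<lambda>t. inverse (c t \<bullet> b) *\<^sub>R c t)"
    using \<delta>(3) by (intro smooth_on_scaleR smooth_on_inverse smooth_on_inner smooth_on_const) auto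
  then have "smooth_on {-\<delta><..<\<delta>} (\<lambda>t. affine_chart b (\<gamma> t))"
    by (rule smooth_on_cong[rotated 2]) (simp_all add: eq)
  moreover have "\<gamma> t \<in> chart_domain b" if "t \<in> {-\<delta><..<\<delta>}" for t
    using c(3,4)[of t] \<delta>(2) \<delta>(3)[OF that] that by (simp add: covering_map_in_chart_domain)
  ultimately show "\<exists>\<delta>>0. (\<forall>t\<in>{-\<delta><..<\<delta>}. \<gamma> t \<in> chart_domain b) \<and>
      smooth_on {-\<delta><..<\<delta>} (\<lambda>t. affine_chart b (\<gamma> t))"
    using \<delta>(1) by blast
qed

lemma velocity_class_smooth:
  assumes "\<gamma> \<in> velocity_class p"
  shows "smooth_curve projective_atlas \<gamma>"
proof (cases p)
  case (Pair x v)
  with assms have \<gamma>: "\<gamma> \<in> velocity_class (x, v)" by simp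
  then have "norm x = 1" using velocity_class_base(2) by (auto simp: tangent_bundle_sphere)
  then obtain b where "b \<in> Basis" "x \<bullet> b \<noteq> 0" by (rule exists_chart)
  with velocity_class_chart(3)[OF \<gamma>, of b] show ?thesis
    unfolding smooth_curve_def projective_atlas_eq by auto
qed

text \<open>The lift is obtained by normalising the chart representation \<open>y\<close>, which never vanishes as
  \<open>y \<bullet> b = 1\<close>.\<close>

lemma smooth_curve_in_velocity_class:
  assumes "smooth_curve projective_atlas \<gamma>"
  shows "\<exists>p \<in> tangent_bundle (sphere 0 1). \<gamma> \<in> velocity_class p"
proof -
  obtain b \<epsilon> where "\<epsilon> > 0" and dom': "\<forall>t\<in>{-\<epsilon><..<\<epsilon>}. \<gamma> t \<in> chart_domain b"
    and sm: "smooth_on {-\<epsilon><..<\<epsilon>} (\<lambda>t. affine_chart b (\<gamma> t))"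
    using assms unfolding smooth_curve_def projective_atlas_eq by auto
  from dom' have dom: "\<gamma> t \<in> chart_domain b" if "t \<in> {-\<epsilon><..<\<epsilon>}" for t using that by blast
  define c where "c = (\<lambda>t. sgn (affine_chart b (\<gamma> t)))"
  have lift: "affine_chart b (\<gamma> t) \<noteq> 0 \<and> \<gamma> t = covering_map (c t)" if t: "t \<in> {-\<epsilon><..<\<epsilon>}" for t
  proof -
    obtain x where x: "norm x = 1" "\<gamma> t = covering_map x"
      using dom[OF t] by (auto simp: chart_domain_def topspace_projective_space)
    then have xb: "x \<bullet> b \<noteq> 0" using dom[OF t] by (simp add: covering_map_in_chart_domain)
    have "affine_chart b (\<gamma> t) = inverse (x \<bullet> b) *\<^sub>R x"
      using affine_chart_covering_map[OF xb] x(2) by simp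
    moreover from this have "c t = x \<or> c t = - x"
      using x(1) by (auto simp: c_def sgn_scaleR_unit sgn_real_def xb)
    ultimately show ?thesis using x xb by (auto simp: covering_map_eq_iff)
  qed
  have "smooth_on {-\<epsilon><..<\<epsilon>} c"
    unfolding c_def by (intro smooth_on_sgn sm) (use lift in \<open>blast intro: open_greaterThanLessThan\<close>)+
  then have "\<gamma> \<in> velocity_class (c 0, vector_derivative c (at 0))"
    using \<open>\<epsilon> > 0\<close> lift
    by (intro velocity_classI[of \<epsilon> c] smooth_on_imp_has_vector_derivative) (auto simp: c_def norm_sgn)
  then show ?thesis using velocity_class_base(2) by blast
qed

text \<open>Pairing with \<open>x\<close>, which is orthogonal to \<open>v\<close> and \<open>w\<close>, isolates the coefficients of \<open>x\<close> in the
  two representations and shows that they agree; what is left is \<open>v\<close> and \<open>w\<close>, scaled equally.\<close>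

lemma chart_rep_inj_fibre:
  assumes "x \<bullet> v = 0" "x \<bullet> w = 0" "norm x = 1" "x \<bullet> b \<noteq> 0"
    and "chart_rep b (x, v) = chart_rep b (x, w)"
  shows "v = w"
proof -
  have eq: "inverse (x \<bullet> b) *\<^sub>R v - ((v \<bullet> b) / (x \<bullet> b)\<^sup>2) *\<^sub>R x
      = inverse (x \<bullet> b) *\<^sub>R w - ((w \<bullet> b) / (x \<bullet> b)\<^sup>2) *\<^sub>R x"
    using assms(5) by (simp add: chart_rep_def)
  from arg_cong[OF eq, of "\<lambda>z. x \<bullet> z"] have "(v \<bullet> b) / (x \<bullet> b)\<^sup>2 = (w \<bullet> b) / (x \<bullet> b)\<^sup>2"
    using assms(1-3) by (simp add: inner_diff_right dot_square_norm)
  with eq assms(4) show ?thesis by simp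
qed

text \<open>Curves with equal lifted velocities have equal velocities in every chart. Conversely, a curve
  with the velocity of \<open>\<gamma>\<close> has a lift starting at \<open>x\<close> or \<open>- x\<close>; changing the sign of that lift if
  necessary, a single chart around the base point determines its velocity.\<close>

lemma velocity_class_is_class:
  assumes "\<gamma> \<in> velocity_class p"
  shows "same_velocity projective_atlas `` {\<gamma>} = velocity_class p"
proof (cases p)
  case (Pair x v)
  with assms have \<gamma>: "\<gamma> \<in> velocity_class (x, v)" by simp
  have x: "norm x = 1" "x \<bullet> v = 0"
    using velocity_class_base(2)[OF \<gamma>] by (auto simp: tangent_bundle_sphere)
  show ?thesis
  proof (intro set_eqI iffI)
    fix \<delta> assume "\<delta> \<in> velocity_class p"
    then have \<delta>: "\<delta> \<in> velocity_class (x, v)" by (simp add: Pair)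
    have "vector_derivative (\<lambda>t. affine_chart b (\<gamma> t)) (at 0)
        = vector_derivative (\<lambda>t. affine_chart b (\<delta> t)) (at 0)"
      if "\<gamma> 0 \<in> chart_domain b" for b
    proof -
      have "x \<bullet> b \<noteq> 0"
        using that x(1) velocity_class_base(1)[OF \<gamma>] by (simp add: covering_map_in_chart_domain)
      then show ?thesis
        using velocity_class_chart(2)[OF \<gamma>] velocity_class_chart(2)[OF \<delta>]
        by (metis vector_derivative_at)
    qed
    then show "\<delta> \<in> same_velocity projective_atlas `` {\<gamma>}"
      using velocity_class_smooth[OF \<gamma>] velocity_class_smooth[OF \<delta>]
        velocity_class_base(1)[OF \<gamma>] velocity_class_base(1)[OF \<delta>]
      by (auto simp: same_velocity_def projective_atlas_eq)
  next
    fix \<delta> assume "\<delta> \<in> same_velocity projective_atlas `` {\<gamma>}"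
    then have sm: "smooth_curve projective_atlas \<delta>" and base: "\<gamma> 0 = \<delta> 0"
      and vel: "\<And>b. b \<in> Basis \<Longrightarrow> \<gamma> 0 \<in> chart_domain b \<Longrightarrow>
        vector_derivative (\<lambda>t. affine_chart b (\<gamma> t)) (at 0)
        = vector_derivative (\<lambda>t. affine_chart b (\<delta> t)) (at 0)"
      by (auto simp: same_velocity_def projective_atlas_eq)
    obtain y w where y: "\<delta> \<in> velocity_class (y, w)"
      using smooth_curve_in_velocity_class[OF sm] by auto
    have "covering_map x = covering_map y"
      using base velocity_class_base(1)[OF \<gamma>] velocity_class_base(1)[OF y] by simp
    then have "y = x \<or> y = - x" by (simp add: covering_map_eq_iff)
    \<comment> \<open>If \<open>y = - x\<close>, the opposite lift starts at \<open>x\<close> and has velocity \<open>u = - w\<close>.\<close>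
    then obtain u where \<delta>: "\<delta> \<in> velocity_class (x, u)"
      using y velocity_class_uminus[of "(x, - w)"] by auto
    have "x \<bullet> u = 0" using velocity_class_base(2)[OF \<delta>] by (simp add: tangent_bundle_sphere)
    obtain b where b: "b \<in> Basis" "x \<bullet> b \<noteq> 0" using x(1) by (rule exists_chart)
    then have "\<gamma> 0 \<in> chart_domain b"
      using x(1) velocity_class_base(1)[OF \<gamma>] by (simp add: covering_map_in_chart_domain)
    then have "snd (chart_rep b (x, v)) = snd (chart_rep b (x, u))"
      using vel[OF b(1)] velocity_class_chart(2)[OF \<gamma> b(2)] velocity_class_chart(2)[OF \<delta> b(2)]
      by (metis vector_derivative_at)
    then have "chart_rep b (x, v) = chart_rep b (x, u)" by (simp add: chart_rep_def)
    then have "v = u" using x b(2) \<open>x \<bullet> u = 0\<close> by (intro chart_rep_inj_fibre[of x v u b]) auto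
    with \<delta> show "\<delta> \<in> velocity_class p" by (simp add: Pair)
  qed
qed

lemma tangent_vectors_projective:
  "tangent_vectors projective_atlas = velocity_class ` tangent_bundle (sphere 0 1)"
proof (intro set_eqI iffI)
  fix \<xi> :: "(real \<Rightarrow> 'a set) set" assume "\<xi> \<in> tangent_vectors projective_atlas"
  then obtain \<gamma> where "smooth_curve projective_atlas \<gamma>" "\<xi> = same_velocity projective_atlas `` {\<gamma>}"
    by (auto simp: tangent_vectors_def elim: quotientE)
  then show "\<xi> \<in> velocity_class ` tangent_bundle (sphere 0 1)"
    using smooth_curve_in_velocity_class velocity_class_is_class by fast
next
  fix \<xi> :: "(real \<Rightarrow> 'a set) set" assume "\<xi> \<in> velocity_class ` tangent_bundle (sphere 0 1)"
  then obtain p where p: "p \<in> tangent_bundle (sphere 0 1)" "\<xi> = velocity_class p" by blast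
  then obtain \<gamma> where "\<gamma> \<in> velocity_class p" using velocity_class_nonempty by blast
  then have "\<xi> = same_velocity projective_atlas `` {\<gamma>}" "smooth_curve projective_atlas \<gamma>"
    using velocity_class_is_class velocity_class_smooth p(2) by blast+
  then show "\<xi> \<in> tangent_vectors projective_atlas"
    by (simp add: tangent_vectors_def quotientI)
qed

text \<open>A lift of a curve in \<open>H\<close> runs in the preimage of \<open>H\<close>, and the image of a curve in this preimage
  runs in \<open>H\<close>.\<close>

lemma velocity_class_in_submanifold_iff:
  assumes "p \<in> tangent_bundle (sphere 0 1)"
  shows "velocity_class p \<in> tangent_vectors_in projective_atlas H \<longleftrightarrow>
    p \<in> tangent_bundle {x \<in> sphere 0 1. covering_map x \<in> H}"
proof (cases p)
  case (Pair x v)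
  show ?thesis
  proof
    assume "velocity_class p \<in> tangent_vectors_in projective_atlas H"
    then obtain \<gamma> \<epsilon>' where \<gamma>: "\<gamma> \<in> velocity_class (x, v)"
      and H: "\<epsilon>' > 0" "\<forall>t\<in>{-\<epsilon>'<..<\<epsilon>'}. \<gamma> t \<in> H"
      by (auto simp: tangent_vectors_in_def Pair)
    obtain \<epsilon> c where c: "\<epsilon> > 0" "smooth_on {-\<epsilon><..<\<epsilon>} c"
      "\<And>t. t \<in> {-\<epsilon><..<\<epsilon>} \<Longrightarrow> norm (c t) = 1"
      "\<And>t. t \<in> {-\<epsilon><..<\<epsilon>} \<Longrightarrow> \<gamma> t = covering_map (c t)"
      "c 0 = x" "(c has_vector_derivative v) (at 0)"
      using \<gamma> by (rule velocity_classE) blast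
    let ?\<delta> = "min \<epsilon> \<epsilon>'"
    have "smooth_on {-?\<delta><..<?\<delta>} c" by (rule smooth_on_subset[OF c(2)]) auto
    moreover have "c t \<in> {x \<in> sphere 0 1. covering_map x \<in> H}" if "t \<in> {-?\<delta><..<?\<delta>}" for t
    proof -
      have "t \<in> {-\<epsilon><..<\<epsilon>}" "t \<in> {-\<epsilon>'<..<\<epsilon>'}" using that by auto
      with c(3,4)[of t] H(2) show ?thesis by (metis (lifting) mem_Collect_eq mem_sphere_0)
    qed
    moreover have "?\<delta> > 0" using c(1) H(1) by simp
    ultimately show "p \<in> tangent_bundle {x \<in> sphere 0 1. covering_map x \<in> H}"
      unfolding Pair tangent_bundle_def using c(5,6) by blast
  next
    assume "p \<in> tangent_bundle {x \<in> sphere 0 1. covering_map x \<in> H}"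
    then obtain \<epsilon> c where c: "\<epsilon> > 0" "smooth_on {-\<epsilon><..<\<epsilon>} c"
      "\<forall>t\<in>{-\<epsilon><..<\<epsilon>}. c t \<in> {x \<in> sphere 0 1. covering_map x \<in> H}"
      "c 0 = x" "(c has_vector_derivative v) (at 0)"
      unfolding Pair tangent_bundle_def by blast
    have "(\<lambda>t. covering_map (c t)) \<in> velocity_class p"
      unfolding Pair using c by (intro velocity_classI[of \<epsilon> c]) auto
    moreover have "\<forall>t\<in>{-\<epsilon><..<\<epsilon>}. covering_map (c t) \<in> H" using c(3) by blast
    moreover have "velocity_class p \<in> tangent_vectors projective_atlas"
      using assms by (simp add: tangent_vectors_projective)
    ultimately show "velocity_class p \<in> tangent_vectors_in projective_atlas H"
      unfolding tangent_vectors_in_def mem_Collect_eq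
      using c(1) by (intro conjI bexI exI[of _ \<epsilon>])
  qed
qed


section \<open>The double covering of tangent bundles\<close>

lemma continuous_on_chart_rep: "continuous_on {p. fst p \<bullet> b \<noteq> 0} (chart_rep b)"
  unfolding chart_rep_def case_prod_unfold by (intro continuous_intros) auto

text \<open>The map induced by \<open>y \<mapsto> y / |y|\<close> on tangent vectors.\<close>

definition radial :: "'a::euclidean_space \<times> 'a \<Rightarrow> 'a \<times> 'a" where
  "radial = (\<lambda>(y, w). (sgn y, inverse (norm y) *\<^sub>R w - ((y \<bullet> w) / norm y ^ 3) *\<^sub>R y))"

lemma continuous_on_radial: "continuous_on {q. fst q \<noteq> 0} radial"
  unfolding radial_def case_prod_unfold sgn_div_norm by (intro continuous_intros) auto

text \<open>\<open>x / (x \<bullet> b)\<close> normalises to \<open>x\<close> or \<open>- x\<close> according to the sign of \<open>x \<bullet> b\<close>, so on tangent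
  vectors \<open>radial\<close> undoes \<open>chart_rep b\<close> up to this sign.\<close>

lemma radial_chart_rep:
  assumes "norm x = 1" "x \<bullet> v = 0" "x \<bullet> b \<noteq> 0"
  shows "radial (chart_rep b (x, v)) = sgn (x \<bullet> b) *\<^sub>R (x, v)"
proof -
  define a where "a = x \<bullet> b"
  define k where "k = v \<bullet> b"
  have a: "a \<noteq> 0" using assms(3) by (simp add: a_def)
  define w where "w = inverse a *\<^sub>R v - (k / a\<^sup>2) *\<^sub>R x"
  have rep: "chart_rep b (x, v) = (inverse a *\<^sub>R x, w)"
    by (simp add: chart_rep_def a_def k_def w_def)
  \<comment> \<open>The norm and the inner product that occur in \<open>radial\<close>.\<close>
  have norm: "norm (inverse a *\<^sub>R x) = inverse \<bar>a\<bar>" using assms(1) by simp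
  have inner: "inverse a *\<^sub>R x \<bullet> w = - (k / a ^ 3)"
    using assms(1,2) a
    by (simp add: w_def inner_diff_right dot_square_norm power2_eq_square power3_eq_cube field_simps)
  have "sgn (inverse a *\<^sub>R x) = sgn a *\<^sub>R x"
    using assms(1) by (rule sgn_scaleR_unit)
  moreover have "inverse (inverse \<bar>a\<bar>) *\<^sub>R w - (- (k / a ^ 3) / inverse \<bar>a\<bar> ^ 3) *\<^sub>R (inverse a *\<^sub>R x)
      = sgn a *\<^sub>R v"
    using a
    by (cases "a > 0")
       (auto simp: w_def algebra_simps power2_eq_square power3_eq_cube divide_inverse)
  ultimately show ?thesis
    unfolding rep radial_def a_def[symmetric] case_prod_conv norm inner by simp
qed

text \<open>The generators of the topology of the tangent bundle of projective space.\<close>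

definition basic_tangent_set :: "'a::euclidean_space \<Rightarrow> ('a \<times> 'a) set \<Rightarrow> (real \<Rightarrow> 'a set) set set" where
  "basic_tangent_set b W = {\<xi> \<in> tangent_vectors projective_atlas. \<exists>\<gamma>\<in>\<xi>. \<gamma> 0 \<in> chart_domain b \<and>
     (affine_chart b (\<gamma> 0), vector_derivative (\<lambda>t. affine_chart b (\<gamma> t)) (at 0)) \<in> W}"

lemma tangent_bundle_topology_projective:
  "tangent_bundle_topology projective_atlas =
     topology_generated_by {basic_tangent_set b W | b W. b \<in> Basis \<and> open W}"
  unfolding tangent_bundle_topology_def basic_tangent_set_def projective_atlas_eq
  by (rule arg_cong[where f = topology_generated_by]) blast

lemma velocity_class_in_basic_iff:
  assumes "(x, v) \<in> tangent_bundle (sphere 0 1)"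
  shows "velocity_class (x, v) \<in> basic_tangent_set b W \<longleftrightarrow>
    x \<bullet> b \<noteq> 0 \<and> chart_rep b (x, v) \<in> W"
proof -
  have x: "norm x = 1" using assms by (simp add: tangent_bundle_sphere)
  have "\<gamma> 0 \<in> chart_domain b \<and>
      (affine_chart b (\<gamma> 0), vector_derivative (\<lambda>t. affine_chart b (\<gamma> t)) (at 0)) \<in> W \<longleftrightarrow>
      x \<bullet> b \<noteq> 0 \<and> chart_rep b (x, v) \<in> W" if \<gamma>: "\<gamma> \<in> velocity_class (x, v)" for \<gamma>
  proof (cases "x \<bullet> b = 0")
    case True
    then show ?thesis
      using velocity_class_base(1)[OF \<gamma>] x by (simp add: covering_map_in_chart_domain)
  next
    case False
    then show ?thesis
      using velocity_class_base(1)[OF \<gamma>] x velocity_class_chart(1)[OF \<gamma> False]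
        vector_derivative_at[OF velocity_class_chart(2)[OF \<gamma> False]]
      by (simp add: covering_map_in_chart_domain)
  qed
  then show ?thesis
    using velocity_class_nonempty[OF assms] assms
    by (auto simp: basic_tangent_set_def tangent_vectors_projective)
qed

lemma topspace_tangent_bundle_projective:
  "topspace (tangent_bundle_topology projective_atlas) =
     velocity_class ` tangent_bundle (sphere (0::'a::euclidean_space) 1)"
proof -
  have "velocity_class p \<in> \<Union>{basic_tangent_set b W | b W. b \<in> Basis \<and> open W}"
    if p: "p \<in> tangent_bundle (sphere 0 1)" for p :: "'a \<times> 'a"
  proof (cases p)
    case (Pair x v)
    then have "norm x = 1" using p by (simp add: tangent_bundle_sphere)
    then obtain b where "b \<in> Basis" "x \<bullet> b \<noteq> 0" by (rule exists_chart)
    then have "velocity_class p \<in> basic_tangent_set b UNIV"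
      using p by (simp add: Pair velocity_class_in_basic_iff)
    then show ?thesis using \<open>b \<in> Basis\<close> by blast
  qed
  then show ?thesis
    unfolding tangent_bundle_topology_projective topology_generated_by_topspace
    by (auto simp: basic_tangent_set_def tangent_vectors_projective)
qed

lemma continuous_map_velocity_class:
  "continuous_map (top_of_set (tangent_bundle (sphere (0::'a::euclidean_space) 1)))
     (tangent_bundle_topology projective_atlas) velocity_class"
  unfolding tangent_bundle_topology_projective
proof (rule continuous_on_generated_topo)
  fix U :: "(real \<Rightarrow> 'a set) set set"
  assume "U \<in> {basic_tangent_set b W | b W. b \<in> Basis \<and> open W}"
  then obtain b W where U: "U = basic_tangent_set b W" and "open W" by blast
  have "open {p :: 'a \<times> 'a. fst p \<bullet> b \<noteq> 0}"
    by (intro open_Collect_neq continuous_intros)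
  then have op: "open ({p. fst p \<bullet> b \<noteq> 0} \<inter> chart_rep b -` W)"
    using continuous_on_chart_rep \<open>open W\<close> by (intro continuous_open_preimage) auto
  have "velocity_class -` U \<inter> topspace (top_of_set (tangent_bundle (sphere (0::'a) 1)))
      = tangent_bundle (sphere (0::'a) 1) \<inter> ({p. fst p \<bullet> b \<noteq> 0} \<inter> chart_rep b -` W)"
    by (auto simp: U velocity_class_in_basic_iff)
  then show "openin (top_of_set (tangent_bundle (sphere (0::'a) 1)))
      (velocity_class -` U \<inter> topspace (top_of_set (tangent_bundle (sphere (0::'a) 1))))"
    using op by (simp add: openin_open_Int)
next
  show "velocity_class ` topspace (top_of_set (tangent_bundle (sphere (0::'a) 1)))
      \<subseteq> \<Union>{basic_tangent_set b W | b W. b \<in> Basis \<and> open W}"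
    using topspace_tangent_bundle_projective[where 'a = 'a]
    unfolding tangent_bundle_topology_projective topology_generated_by_topspace by (simp only: topspace_euclidean_subtopology order_refl)
qed

text \<open>Around the image of \<open>(x, v) \<in> U\<close>, the vectors whose chart representation is sent by
  \<open>s *\<^sub>R radial\<close> into the open set that cuts out \<open>U\<close> form a basic open set, where \<open>s\<close> is the sign
  of \<open>x \<bullet> b\<close>. Such a vector is the image of some \<open>(y, w)\<close>, and by \<open>radial_chart_rep\<close> one of
  \<open>(y, w)\<close> and \<open>- (y, w)\<close> lies in \<open>U\<close>; both have the same image.\<close>

lemma open_map_velocity_class:
  "open_map (top_of_set (tangent_bundle (sphere (0::'a::euclidean_space) 1)))
     (tangent_bundle_topology projective_atlas) velocity_class"
  unfolding open_map_def
proof (intro allI impI)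
  fix U :: "('a \<times> 'a) set"
  let ?TS = "tangent_bundle (sphere (0::'a) 1)"
  assume "openin (top_of_set ?TS) U"
  then obtain O' where "open O'" and U: "U = ?TS \<inter> O'" by (auto simp: openin_open)
  show "openin (tangent_bundle_topology projective_atlas) (velocity_class ` U)"
  proof (subst openin_subopen, intro ballI)
    fix \<xi> assume "\<xi> \<in> velocity_class ` U"
    then obtain x v where xv: "(x, v) \<in> U" "\<xi> = velocity_class (x, v)" by auto
    then have x: "(x, v) \<in> ?TS" "norm x = 1" "x \<bullet> v = 0" by (auto simp: U tangent_bundle_sphere)
    obtain b where b: "b \<in> Basis" "x \<bullet> b \<noteq> 0" using x(2) by (rule exists_chart)
    define s where "s = sgn (x \<bullet> b)"
    define W where "W = {q. fst q \<noteq> 0} \<inter> (\<lambda>q. s *\<^sub>R radial q) -` O'"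
    have "open {q :: 'a \<times> 'a. fst q \<noteq> 0}" by (intro open_Collect_neq continuous_intros)
    then have "open W"
      unfolding W_def using \<open>open O'\<close>
      by (intro continuous_open_preimage continuous_on_scaleR continuous_on_const continuous_on_radial)
    have s: "s = 1 \<or> s = - 1" "s * s = 1" using b(2) by (auto simp: s_def sgn_real_def)
    have "velocity_class (x, v) \<in> basic_tangent_set b W"
    proof -
      have "s *\<^sub>R radial (chart_rep b (x, v)) = (x, v)"
        using radial_chart_rep[OF x(2,3) b(2)] s(2) by (simp add: s_def[symmetric])
      moreover have "fst (chart_rep b (x, v)) \<noteq> 0" using x(2) b(2) by (auto simp: chart_rep_def)
      ultimately show ?thesis using velocity_class_in_basic_iff[OF x(1)] b(2) xv(1) by (auto simp: W_def U)
    qed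
    moreover have "basic_tangent_set b W \<subseteq> velocity_class ` U"
    proof
      fix \<eta> assume \<eta>: "\<eta> \<in> basic_tangent_set b W"
      then obtain y w where y: "(y, w) \<in> ?TS" "\<eta> = velocity_class (y, w)"
        by (auto simp: basic_tangent_set_def tangent_vectors_projective)
      then have yb: "y \<bullet> b \<noteq> 0" "s *\<^sub>R radial (chart_rep b (y, w)) \<in> O'"
        using \<eta> velocity_class_in_basic_iff[OF y(1)] by (auto simp: W_def)
      then have "(s * sgn (y \<bullet> b)) *\<^sub>R (y, w) \<in> O'"
        using radial_chart_rep[of y w b] y(1) by (simp add: tangent_bundle_sphere)
      moreover have "s * sgn (y \<bullet> b) = 1 \<or> s * sgn (y \<bullet> b) = - 1"
        using s(1) yb(1) by (auto simp: sgn_real_def)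
      ultimately have "(y, w) \<in> O' \<or> - (y, w) \<in> O'" by auto
      then show "\<eta> \<in> velocity_class ` U"
      proof
        assume "- (y, w) \<in> O'"
        then have "- (y, w) \<in> U" using y(1) by (simp add: U del: uminus_Pair)
        then show ?thesis using y(2) velocity_class_uminus[of "(y, w)"] by (metis imageI)
      qed (use y in \<open>auto simp: U\<close>)
    qed
    moreover have "openin (tangent_bundle_topology projective_atlas) (basic_tangent_set b W)"
      unfolding tangent_bundle_topology_projective
      using b(1) \<open>open W\<close> by (intro topology_generated_by_Basis) blast
    ultimately show "\<exists>T. openin (tangent_bundle_topology projective_atlas) T \<and> \<xi> \<in> T \<and>
        T \<subseteq> velocity_class ` U"
      using xv(2) by blast
  qed
qed

text \<open>Equal classes have equal representations in a chart around their base point, and \<open>radial\<close>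
  recovers both \<open>p\<close> and \<open>q\<close> from it up to sign.\<close>

lemma velocity_class_eq_iff:
  assumes "p \<in> tangent_bundle (sphere 0 1)" "q \<in> tangent_bundle (sphere 0 1)"
  shows "velocity_class p = velocity_class q \<longleftrightarrow> q = p \<or> q = - p"
proof
  assume eq: "velocity_class p = velocity_class q"
  obtain x v y w where pq: "p = (x, v)" "q = (y, w)" by (metis surj_pair)
  have x: "norm x = 1" "x \<bullet> v = 0" and y: "norm y = 1" "y \<bullet> w = 0"
    using assms by (auto simp: pq tangent_bundle_sphere)
  obtain b where b: "b \<in> Basis" "x \<bullet> b \<noteq> 0" using x(1) by (rule exists_chart)
  \<comment> \<open>The basic set of a single point expresses that the chart representations are equal.\<close>
  have "velocity_class (y, w) \<in> basic_tangent_set b {chart_rep b (x, v)}"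
    using velocity_class_in_basic_iff[of x v b "{chart_rep b (x, v)}"] assms(1) b(2) eq
    by (simp add: pq)
  then have yb: "y \<bullet> b \<noteq> 0" and rep: "chart_rep b (y, w) = chart_rep b (x, v)"
    using velocity_class_in_basic_iff[of y w b "{chart_rep b (x, v)}"] assms(2) by (simp_all add: pq)
  have "sgn (x \<bullet> b) *\<^sub>R p = sgn (y \<bullet> b) *\<^sub>R q"
    using radial_chart_rep[OF x b(2)] radial_chart_rep[OF y yb] rep unfolding pq by simp
  then show "q = p \<or> q = - p"
    using b(2) yb by (auto simp: sgn_real_def split: if_splits)
qed auto

section \<open>The quotient description of the complement\<close>

lemma quotient_maps_same_fibres_imp_homeomorphic:
  assumes f: "quotient_map X Y f" and g: "quotient_map X Z g"
    and fibres: "\<And>x y. x \<in> topspace X \<Longrightarrow> y \<in> topspace X \<Longrightarrow> f x = f y \<longleftrightarrow> g x = g y"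
  shows "Y homeomorphic_space Z"
proof -
  obtain h where h: "continuous_map Y Z h" "\<And>x. x \<in> topspace X \<Longrightarrow> h (f x) = g x"
    using quotient_map_lift_exists[OF f quotient_imp_continuous_map[OF g]] fibres by metis
  obtain k where k: "continuous_map Z Y k" "\<And>x. x \<in> topspace X \<Longrightarrow> k (g x) = f x"
    using quotient_map_lift_exists[OF g quotient_imp_continuous_map[OF f]] fibres by metis
  have "homeomorphic_maps Y Z h k"
    unfolding homeomorphic_maps_def
    using h k unfolding quotient_imp_surjective_map[OF f, symmetric] quotient_imp_surjective_map[OF g, symmetric]
    by simp
  then show ?thesis unfolding homeomorphic_space_def by blast
qed

lemma sphere_complement_lifted_arrangement:
  fixes \<A> :: "'a::euclidean_space set set set"
  shows "sphere_complement (lifted_arrangement \<A>) = {p \<in> tangent_bundle (sphere 0 1).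
     velocity_class p \<in> tangent_vectors projective_atlas -
       (\<Union>H\<in>\<A>. tangent_vectors_in projective_atlas H)}"
proof (rule set_eqI)
  fix p :: "'a \<times> 'a"
  show "p \<in> sphere_complement (lifted_arrangement \<A>) \<longleftrightarrow> p \<in> {p \<in> tangent_bundle (sphere 0 1).
     velocity_class p \<in> tangent_vectors projective_atlas -
       (\<Union>H\<in>\<A>. tangent_vectors_in projective_atlas H)}"
  proof (cases "p \<in> tangent_bundle (sphere 0 1)")
    case True
    then have "velocity_class p \<in> tangent_vectors projective_atlas"
      by (simp add: tangent_vectors_projective)
    then show ?thesis
      using True
      by (simp only: sphere_complement_def lifted_arrangement_def image_image Diff_iff UN_iff
          mem_Collect_eq velocity_class_in_submanifold_iff[OF True] simp_thms)
  qed (simp add: sphere_complement_def)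
qed

text \<open>Openness survives the restriction to the complements because the complement upstairs is the full
  preimage of the one downstairs.\<close>

lemma quotient_map_velocity_class_complement:
  fixes \<A> :: "'a::euclidean_space set set set"
  shows "quotient_map (top_of_set (sphere_complement (lifted_arrangement \<A>)))
     (projective_complement \<A>) velocity_class"
proof -
  define TS where "TS = tangent_bundle (sphere (0::'a) 1)"
  define C where "C = sphere_complement (lifted_arrangement \<A>)"
  define P where "P = tangent_vectors projective_atlas -
    (\<Union>H\<in>\<A>. tangent_vectors_in projective_atlas H)"
  have CP: "{p \<in> TS. velocity_class p \<in> P} = C"
    unfolding TS_def C_def P_def by (rule sphere_complement_lifted_arrangement[symmetric])
  have P: "P \<subseteq> velocity_class ` TS"
    unfolding P_def TS_def tangent_vectors_projective by (rule Diff_subset)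
  have PC: "projective_complement \<A> = subtopology (tangent_bundle_topology projective_atlas) P"
    by (simp add: projective_complement_def P_def)
  have sub: "subtopology (top_of_set TS) C = top_of_set C"
    using CP by (auto simp: subtopology_subtopology intro!: arg_cong[where f = top_of_set])
  have img: "velocity_class ` C = P" using CP P by blast
  have "open_map (top_of_set C) (projective_complement \<A>) velocity_class"
    using open_map_restriction[OF open_map_velocity_class, of P C] CP
    unfolding PC sub[symmetric] TS_def by simp
  moreover have "continuous_map (top_of_set C) (projective_complement \<A>) velocity_class"
    unfolding PC sub[symmetric] TS_def
    by (rule continuous_map_into_subtopology
        [OF continuous_map_from_subtopology[OF continuous_map_velocity_class]])
       (use img in auto)
  moreover have "topspace (projective_complement \<A>) = P"
    using P unfolding PC topspace_subtopology topspace_tangent_bundle_projective TS_def by blast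
  ultimately have "quotient_map (top_of_set C) (projective_complement \<A>) velocity_class"
    using img by (intro continuous_open_imp_quotient_map) simp_all
  then show ?thesis by (simp only: C_def)
qed

theorem theorem6p2:
  fixes \<A> :: "'a::euclidean_space set set set" and l :: nat
  assumes "DIM('a) = l + 1"
    and "projective_arrangement l \<A>"
  shows "homeomorphic_map (top_of_set (tangent_bundle (sphere (0::'a) 1)))
           (top_of_set (tangent_bundle (sphere (0::'a) 1))) tangent_antipode \<and>
         (\<forall>x \<in> sphere (0::'a) 1. (x, 0) \<in> tangent_bundle (sphere 0 1) \<and>
           tangent_antipode (x, 0) = (- x, 0)) \<and>
         (\<forall>(x, v) \<in> tangent_bundle (sphere (0::'a) 1).
           tangent_antipode (x, v) = (- x, frechet_derivative uminus (at x) v)) \<and>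
         tangent_antipode ` sphere_complement (lifted_arrangement \<A>) =
           sphere_complement (lifted_arrangement \<A>) \<and>
         projective_complement \<A> homeomorphic_space
           involution_quotient (top_of_set (sphere_complement (lifted_arrangement \<A>)))
             tangent_antipode"
proof (intro conjI)
  let ?TS = "tangent_bundle (sphere (0::'a) 1)"
  let ?C = "sphere_complement (lifted_arrangement \<A>)"
  have antipode: "tangent_antipode = (uminus :: 'a \<times> 'a \<Rightarrow> _)"
    by (simp add: fun_eq_iff tangent_antipode_eq)
  have "homeomorphic_maps (top_of_set ?TS) (top_of_set ?TS) uminus uminus"
    by (auto simp: homeomorphic_maps_def intro!: continuous_intros)
  then show "homeomorphic_map (top_of_set ?TS) (top_of_set ?TS) tangent_antipode"
    unfolding antipode homeomorphic_map_maps by blast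
  show "\<forall>x \<in> sphere (0::'a) 1. (x, 0) \<in> ?TS \<and> tangent_antipode (x, 0) = (- x, 0)"
    by (simp add: tangent_bundle_sphere tangent_antipode_def)
  have "frechet_derivative uminus (at x) = uminus" for x :: 'a
    by (rule frechet_derivative_at[symmetric]) (auto intro!: derivative_eq_intros)
  then show "\<forall>(x, v) \<in> ?TS. tangent_antipode (x, v) = (- x, frechet_derivative uminus (at x) v)"
    by (simp add: tangent_antipode_def)
  have "- p \<in> ?C" if "p \<in> ?C" for p
    using that by (simp add: sphere_complement_lifted_arrangement)
  then show "tangent_antipode ` ?C = ?C"
    unfolding antipode by (force intro: image_eqI[where x = "- _"])
  show "projective_complement \<A> homeomorphic_space
      involution_quotient (top_of_set ?C) tangent_antipode"
    unfolding involution_quotient_def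
  proof (rule quotient_maps_same_fibres_imp_homeomorphic[OF
        quotient_map_velocity_class_complement quotient_map_quotient_topology])
    fix p q assume "p \<in> topspace (top_of_set ?C)" "q \<in> topspace (top_of_set ?C)"
    then have "p \<in> ?TS" "q \<in> ?TS" by (auto simp: sphere_complement_def)
    then show "velocity_class p = velocity_class q \<longleftrightarrow>
        {p, tangent_antipode p} = {q, tangent_antipode q}"
      by (auto simp: velocity_class_eq_iff doubleton_eq_iff tangent_antipode_eq)
  qed
qed

end
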